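(* Let $m\ge 1$ be an integer and let $0<\rho\le 1$. Consider the deterministic Fukui–Ishibashi traffic cellular automaton with maximum speed $m$ on the infinite lattice $\mathbb{Z}$, started at time $0$ from the random configuration in which the sites are independently occupied with probability $\rho$ and empty with probability $1-\rho$. Then $$\lim_{t\to\infty}P_t(0^{m+1})=\begin{cases}1-(m+1)\rho & \text{if } \rho<1/(m+1),\\ 0&\text{otherwise,}\end{cases}$$ and the average flow in the steady state is $$\lim_{t\to\infty}\phi_m(t)=\begin{cases}m\rho & \text{if } \rho<1/(m+1),\\ 1-\rho&\text{otherwise.}\end{cases}$$
   Context: Fukui–Ishibashi (F-I) model with maximum speed $m$: each site of $\mathbb{Z}$ is occupied by a car (state 1) or empty (state 0). At every discrete time step all cars simultaneously move to the right: a car having exactly $g$ empty sites between itself and the next car to its right advances by $\min(g,m)$ sites. Equivalently, it is the cellular automaton $s(i,t+1)=f_m(s(i-m,t),\ldots,s(i+1,t))$ where $s(i,t+1)=1$ if and only if one of the following holds at time $t$: (a) $s(i)=1$ and $s(i+1)=1$; (b) $s(i)=0$, $s(i+1)=1$ and $s(i-j)=1$ for some $1\le j\le m$; (c) $s(i)=0$, $s(i-m)=1$ and $s(i-j)=0$ for all $1\le j\le m-1$. For a finite binary block $B$, $P_t(B)$ denotes the probability that $B$ occurs at a given position (say starting at site $0$) of the configuration at time $t$; it does not depend on the position by translation invariance. $0^k$ denotes $k$ consecutive zeros. The average flow (density $\rho$ times average car velocity) is $$\phi_m(t)=\sum_{k=1}^{m-1}k\,P_t(10^k1)+m\,P_t(10^m).$$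 *)

theory Defs
  imports "HOL-Probability.Probability"
begin

text \<open>A configuration of the road is a function \<open>s :: int \<Rightarrow> bool\<close>, where \<open>s i\<close> means that
  site \<open>i\<close> is occupied by a car.\<close>

definition fi_step :: "nat \<Rightarrow> (int \<Rightarrow> bool) \<Rightarrow> (int \<Rightarrow> bool)" where
  "fi_step m s = (\<lambda>i.
      (s i \<and> s (i + 1)) \<or>
      (\<not> s i \<and> s (i + 1) \<and> (\<exists>j\<in>{1..m}. s (i - int j))) \<or>
      (\<not> s i \<and> s (i - int m) \<and> (\<forall>j\<in>{1..m - 1}. \<not> s (i - int j))))"

text \<open>The same dynamics in terms of moving cars: with \<open>g\<close> empty sites ahead of the car at \<open>k\<close>,
  \<open>fi_advance m s k\<close> is \<open>min g m\<close>; it is \<open>m\<close> if there is no car to the right of \<open>k\<close>.\<close>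

definition fi_advance :: "nat \<Rightarrow> (int \<Rightarrow> bool) \<Rightarrow> int \<Rightarrow> nat" where
  "fi_advance m s k = (GREATEST d. d \<le> m \<and> (\<forall>j\<in>{1..d}. \<not> s (k + int j)))"

lemma fi_advance_eqI:
  assumes "d \<le> m" "\<And>j. 1 \<le> j \<Longrightarrow> j \<le> d \<Longrightarrow> \<not> s (k + int j)"
    and "d = m \<or> s (k + int d + 1)"
  shows "fi_advance m s k = d"
  unfolding fi_advance_def
proof (rule Greatest_equality)
  show "d \<le> m \<and> (\<forall>j\<in>{1..d}. \<not> s (k + int j))" using assms by auto
next
  fix e assume e: "e \<le> m \<and> (\<forall>j\<in>{1..e}. \<not> s (k + int j))"
  show "e \<le> d"
  proof (rule ccontr)
    assume "\<not> e \<le> d"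
    hence "Suc d \<in> {1..e}" by auto
    hence "\<not> s (k + int (Suc d))" using e by blast
    hence "\<not> s (k + int d + 1)" by (simp add: algebra_simps)
    with assms(3) e \<open>\<not> e \<le> d\<close> show False by auto
  qed
qed

lemma fi_advance_props:
  shows "fi_advance m s k \<le> m"
    and "1 \<le> j \<Longrightarrow> j \<le> fi_advance m s k \<Longrightarrow> \<not> s (k + int j)"
    and "fi_advance m s k = m \<or> s (k + int (fi_advance m s k) + 1)"
proof -
  let ?P = "\<lambda>d. d \<le> m \<and> (\<forall>j\<in>{1..d}. \<not> s (k + int j))"
  let ?d = "fi_advance m s k"
  have P: "?P ?d" unfolding fi_advance_def
    by (rule GreatestI_nat[of ?P 0 m]) auto
  show "?d \<le> m" using P by simp
  show "1 \<le> j \<Longrightarrow> j \<le> ?d \<Longrightarrow> \<not> s (k + int j)" using P by auto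
  show "?d = m \<or> s (k + int ?d + 1)"
  proof (rule ccontr)
    assume n: "\<not> (?d = m \<or> s (k + int ?d + 1))"
    have "?P (Suc ?d)"
    proof (intro conjI ballI)
      show "Suc ?d \<le> m" using P n by simp
      fix j assume "j \<in> {1..Suc ?d}"
      then consider "j \<in> {1..?d}" | "j = Suc ?d" by fastforce
      then show "\<not> s (k + int j)"
        using P n by cases (auto simp: algebra_simps)
    qed
    hence "Suc ?d \<le> ?d" unfolding fi_advance_def
      by (rule Greatest_le_nat[of ?P _ m]) auto
    thus False by simp
  qed
qed

lemma fi_step_iff_advance:
  assumes "m \<ge> 1"
  shows "fi_step m s i \<longleftrightarrow> (\<exists>k. s k \<and> i = k + int (fi_advance m s k))"
proof
  assume "fi_step m s i"
  then consider (a) "s i" "s (i + 1)"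
    | (b) "\<not> s i" "s (i + 1)" "\<exists>j\<in>{1..m}. s (i - int j)"
    | (c) "\<not> s i" "s (i - int m)" "\<forall>j\<in>{1..m - 1}. \<not> s (i - int j)"
    unfolding fi_step_def by blast
  then show "\<exists>k. s k \<and> i = k + int (fi_advance m s k)"
  proof cases
    case a
    have "fi_advance m s i = 0" using a by (intro fi_advance_eqI) auto
    with a show ?thesis by (intro exI[of _ i]) auto
  next
    case b
    define d where "d = (LEAST j. 1 \<le> j \<and> s (i - int j))"
    obtain j where j: "1 \<le> j \<and> s (i - int j)" "j \<le> m" using b(3) by auto
    have d: "1 \<le> d \<and> s (i - int d)" unfolding d_def using j(1) by (rule LeastI)
    have le: "d \<le> j" unfolding d_def using j(1) by (rule Least_le)
    have least: "\<not> s (i - int l)" if "l < d" for l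
      using that not_less_Least[of l "\<lambda>j. 1 \<le> j \<and> s (i - int j)"] b(1)
      unfolding d_def by (cases "l = 0") auto
    have "fi_advance m s (i - int d) = d"
    proof (rule fi_advance_eqI)
      show "d \<le> m" using le j by simp
      show "\<not> s (i - int d + int l)" if "1 \<le> l" "l \<le> d" for l
        using least[of "d - l"] that by (simp add: of_nat_diff algebra_simps)
      show "d = m \<or> s (i - int d + int d + 1)" using b by simp
    qed
    with d show ?thesis by (intro exI[of _ "i - int d"]) auto
  next
    case c
    have "fi_advance m s (i - int m) = m"
    proof (rule fi_advance_eqI)
      show "\<not> s (i - int m + int l)" if "1 \<le> l" "l \<le> m" for l
      proof (cases "l = m")
        case False
        hence "m - l \<in> {1..m - 1}" using that by auto
        hence "\<not> s (i - int (m - l))" using c by blast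
        thus ?thesis using that by (simp add: of_nat_diff algebra_simps)
      qed (use c in simp)
    qed auto
    with c show ?thesis by (intro exI[of _ "i - int m"]) auto
  qed
next
  assume "\<exists>k. s k \<and> i = k + int (fi_advance m s k)"
  then obtain k where k: "s k" "i = k + int (fi_advance m s k)" by blast
  define d where "d = fi_advance m s k"
  have i: "i = k + int d" using k d_def by simp
  note p = fi_advance_props[where m = m and s = s and k = k, folded d_def]
  show "fi_step m s i"
  proof (cases "d = 0")
    case True
    thus ?thesis using p(3) k(1) i assms unfolding fi_step_def by auto
  next
    case False
    hence ni: "\<not> s i" using p(2)[of d] i p by auto
    from p(3) show ?thesis
    proof
      assume dm: "d = m"
      have "\<not> s (i - int j)" if "j \<in> {1..m - 1}" for j
      proof -
        have "1 \<le> m - j" "m - j \<le> d" "int (m - j) = int m - int j"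
          using that dm by auto
        thus ?thesis using p(2)[of "m - j"] dm i by (simp add: algebra_simps)
      qed
      thus ?thesis using ni dm i k(1) unfolding fi_step_def by auto
    next
      assume "s (k + int d + 1)"
      moreover have "\<exists>j\<in>{1..m}. s (i - int j)"
        using False p(1) i k(1) by (intro bexI[of _ d]) auto
      ultimately show ?thesis using ni i unfolding fi_step_def by auto
    qed
  qed
qed

definition bernoulli_config :: "real \<Rightarrow> (int \<Rightarrow> bool) measure" where
  "bernoulli_config \<rho> = (\<Pi>\<^sub>M i\<in>UNIV. measure_pmf (bernoulli_pmf \<rho>))"

definition block_at :: "(int \<Rightarrow> bool) \<Rightarrow> int \<Rightarrow> bool list \<Rightarrow> bool" where
  "block_at s i B \<longleftrightarrow> (\<forall>k<length B. s (i + int k) = B ! k)"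

definition block_prob :: "nat \<Rightarrow> real \<Rightarrow> nat \<Rightarrow> bool list \<Rightarrow> real" where
  "block_prob m \<rho> t B =
     \<P>(s in bernoulli_config \<rho>. block_at ((fi_step m ^^ t) s) 0 B)"

definition flow :: "nat \<Rightarrow> real \<Rightarrow> nat \<Rightarrow> real" where
  "flow m \<rho> t =
     (\<Sum>k = 1..m - 1. real k * block_prob m \<rho> t ([True] @ replicate k False @ [True]))
     + real m * block_prob m \<rho> t ([True] @ replicate m False)"

lemma measurable_fi_step_iterate:
  "Measurable.pred (bernoulli_config \<rho>) (\<lambda>s. (fi_step m ^^ t) s i)"
proof (induction t arbitrary: i)
  case 0
  have "(\<lambda>s. s i) \<in> bernoulli_config \<rho> \<rightarrow>\<^sub>M measure_pmf (bernoulli_pmf \<rho>)"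
    unfolding bernoulli_config_def by (rule measurable_component_singleton) simp
  also have "\<dots> = bernoulli_config \<rho> \<rightarrow>\<^sub>M count_space UNIV"
    by (rule measurable_cong_sets) auto
  finally show ?case by simp
next
  case (Suc t)
  note [measurable] = Suc.IH
  have "(fi_step m ^^ Suc t) s i \<longleftrightarrow>
      (let u = (fi_step m ^^ t) s in
        (u i \<and> u (i + 1)) \<or>
        (\<not> u i \<and> u (i + 1) \<and> (\<exists>j\<in>{1..m}. u (i - int j))) \<or>
        (\<not> u i \<and> u (i - int m) \<and> (\<forall>j\<in>{1..m - 1}. \<not> u (i - int j))))" for s
    by (simp add: fi_step_def[of m "(fi_step m ^^ t) s"] Let_def)
  then show ?case by (simp only: Let_def) measurable
qed

lemma block_event_measurable:
  "{s \<in> space (bernoulli_config \<rho>). block_at ((fi_step m ^^ t) s) i B}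
     \<in> sets (bernoulli_config \<rho>)"
proof -
  note [measurable] = measurable_fi_step_iterate
  show ?thesis unfolding block_at_def by measurable
qed

end

(*
  The number of cars to the left of a site, as a function h of the site, evolves by the max-plus
  linear rule h'(i) = max (h(i - m)) (h(i + 1) - 1). Iterating it shows that 0^(m+1) occurs at time
  t iff the first j blocks of m + 1 sites in a window of the initial configuration contain fewer
  than j cars, for every j = 1, ..., t + 1.

  Reading the window from right to left, this is the event that a queue with one departure per
  time slot, fed with the independent numbers of cars in the blocks, is idle in slot t + 1. If w and
  v are the first two moments of the queue length and nu = (m + 1) rho - 1 is the drift, then the
  idle probability q(n) satisfies w(n + 1) = w(n) + nu + q(n), and nonnegativity of the variance
  v - w^2 forces its limit p to satisfy p (p + nu) = 0, whence p = max 0 (- nu).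

  The flow equals 1 - rho - P_t(0^(m+1)), because the density of cars is conserved.
*)

theory Submission
  imports Defs
begin

section \<open>The height function\<close>

text \<open>On the infinite road the number of all cars to the left of a site may be infinite, so
  only increments are prescribed. Heights are determined up to an additive constant, hence a
  predicate and not a function of \<open>s\<close>.\<close>

definition is_height :: "(int \<Rightarrow> int) \<Rightarrow> (int \<Rightarrow> bool) \<Rightarrow> bool" where
  "is_height h s \<longleftrightarrow> (\<forall>i. h (i + 1) = h i + of_bool (s (i + 1)))"

definition height_step :: "nat \<Rightarrow> (int \<Rightarrow> int) \<Rightarrow> int \<Rightarrow> int" where
  "height_step m h i = max (h (i - int m)) (h (i + 1) - 1)"

text \<open>In the next step some car moves from a site \<open>\<le> i\<close> to a site \<open>> i\<close>.\<close>

definition crosses :: "nat \<Rightarrow> (int \<Rightarrow> bool) \<Rightarrow> int \<Rightarrow> bool" where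
  "crosses m s i \<longleftrightarrow> \<not> s (i + 1) \<and> (\<exists>j<m. s (i - int j))"

text \<open>The local conservation law, with \<open>crosses\<close> as the current: at most one car
  per step passes from a site to its right neighbour. The type is generic because heights need the
  law over \<open>int\<close> and expectations need it over \<open>real\<close>.\<close>

lemma fi_step_conservation:
  assumes "m \<ge> 1"
  shows "of_bool (fi_step m s i) + of_bool (crosses m s i)
    = (of_bool (s i) + of_bool (crosses m s (i - 1)) :: 'a :: linordered_idom)"
proof -
  have ex0: "(\<exists>j<m. s (i - int j)) \<longleftrightarrow> s i \<or> (\<exists>j\<in>{1..m - 1}. s (i - int j))"
  proof -
    have "{..<m} = insert 0 {1..m - 1}" using assms by auto
    hence "(\<exists>j\<in>{..<m}. s (i - int j)) \<longleftrightarrow> s i \<or> (\<exists>j\<in>{1..m - 1}. s (i - int j))" by auto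
    thus ?thesis by auto
  qed
  have ex1: "(\<exists>j<m. s (i - 1 - int j)) \<longleftrightarrow> (\<exists>j\<in>{1..m}. s (i - int j))"
  proof -
    have "{1..m} = Suc ` {..<m}" by (simp add: image_Suc_lessThan)
    hence "(\<exists>j\<in>{1..m}. s (i - int j)) \<longleftrightarrow> (\<exists>j\<in>{..<m}. s (i - 1 - int j))"
      by (simp add: algebra_simps)
    thus ?thesis by auto
  qed
  have "{1..m} = insert m {1..m - 1}" using assms by auto
  hence ex2: "(\<exists>j\<in>{1..m}. s (i - int j)) \<longleftrightarrow> s (i - int m) \<or> (\<exists>j\<in>{1..m - 1}. s (i - int j))"
    by auto
  have nex: "(\<forall>j\<in>{1..m - 1}. \<not> s (i - int j)) \<longleftrightarrow> \<not> (\<exists>j\<in>{1..m - 1}. s (i - int j))"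
    by blast
  have i: "i - 1 + 1 = i" by simp
  \<comment> \<open>After these rewritings both sides depend on four truth values only.\<close>
  show ?thesis
    unfolding fi_step_def crosses_def ex0 ex1 ex2 nex i
    by (cases "\<exists>j\<in>{1..m - 1}. s (i - int j)"; cases "s i"; cases "s (i + 1)"; cases "s (i - int m)")
       (simp_all only: simp_thms of_bool_eq)
qed

lemma height_add:
  assumes "is_height h s"
  shows "h (i + int n) = h i + (\<Sum>k<n. of_bool (s (i + 1 + int k)))"
proof (induction n)
  case (Suc n)
  have "h (i + int (Suc n)) = h (i + int n + 1)" by (simp add: algebra_simps)
  also have "\<dots> = h (i + int n) + of_bool (s (i + int n + 1))"
    using assms unfolding is_height_def by blast
  finally show ?case using Suc by (simp add: algebra_simps)
qed simp

text \<open>The arguments of the maximum are \<open>h i\<close> minus the number of cars on the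
  \<open>m\<close> sites ending at \<open>i\<close>, and \<open>h i\<close> or
  \<open>h i - 1\<close> according to whether \<open>i + 1\<close> is occupied. Both lie below
  \<open>h i\<close> iff \<open>crosses\<close> holds, and then the larger one is
  \<open>h i - 1\<close>.\<close>

lemma height_step:
  assumes "is_height h s" "m \<ge> 1"
  shows "height_step m h i = h i - of_bool (crosses m s i)"
proof -
  have 1: "h (i + 1) = h i + of_bool (s (i + 1))" using assms(1) unfolding is_height_def by blast
  have 2: "h i = h (i - int m) + (\<Sum>k<m. of_bool (s (i - int m + 1 + int k)))"
    using height_add[OF assms(1), of "i - int m" m] by simp
  have 3: "(\<Sum>k<m. of_bool (s (i - int m + 1 + int k))) = (\<Sum>j<m. (of_bool (s (i - int j)) :: int))"
    by (rule sum.reindex_bij_witness[of _ "\<lambda>j. m - 1 - j" "\<lambda>j. m - 1 - j"])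
       (auto simp: of_nat_diff algebra_simps)
  let ?S = "\<Sum>j<m. (of_bool (s (i - int j)) :: int)"
  show ?thesis
  proof (cases "\<exists>j<m. s (i - int j)")
    case True
    then obtain j where "j < m" "s (i - int j)" by blast
    hence "of_bool (s (i - int j)) \<le> ?S" by (intro member_le_sum) auto
    hence "?S \<ge> 1" using \<open>s (i - int j)\<close> by simp
    thus ?thesis using 1 2 3 True unfolding height_step_def crosses_def by auto
  next
    case False
    hence "?S = 0" by (intro sum.neutral) auto
    thus ?thesis using 1 2 3 False unfolding height_step_def crosses_def by auto
  qed
qed

lemma height_fi_step:
  assumes "is_height h s" "m \<ge> 1"
  shows "is_height (height_step m h) (fi_step m s)"
  unfolding is_height_def
proof
  fix i
  have "h (i + 1) = h i + of_bool (s (i + 1))" using assms(1) unfolding is_height_def by blast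
  thus "height_step m h (i + 1) = height_step m h i + of_bool (fi_step m s (i + 1))"
    using fi_step_conservation[OF assms(2), of s "i + 1", where 'a = int]
    by (simp add: height_step[OF assms])
qed

lemma height_fi_step_iterate:
  assumes "is_height h s" "m \<ge> 1"
  shows "is_height ((height_step m ^^ t) h) ((fi_step m ^^ t) s)"
  by (induction t) (auto intro: assms height_fi_step)

text \<open>Unrolling gives a maximum over paths of \<open>t\<close> steps: \<open>m\<close> sites
  to the left for free, or one site to the right at cost 1. Only the number \<open>k\<close> of
  right steps matters, the end point being \<open>i - m * (t - k) + k\<close>. Upper bounds
  \<open>x\<close> stand in for the maximum.\<close>

lemma height_step_iterate_le_iff:
  "(height_step m ^^ t) h i \<le> x \<longleftrightarrow>
    (\<forall>k\<le>t. h (i - int m * int t + (int m + 1) * int k) - int k \<le> x)"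
proof (induction t arbitrary: i x)
  case (Suc t)
  let ?a = "\<lambda>k. h (i - int m * int (Suc t) + (int m + 1) * int k) - int k"
  have e1: "i - int m - int m * int t + (int m + 1) * int k
      = i - int m * int (Suc t) + (int m + 1) * int k" for k by (simp add: algebra_simps)
  have e2: "i + 1 - int m * int t + (int m + 1) * int k
      = i - int m * int (Suc t) + (int m + 1) * int (Suc k)" for k by (simp add: algebra_simps)
  have "(height_step m ^^ Suc t) h i \<le> x \<longleftrightarrow>
      (height_step m ^^ t) h (i - int m) \<le> x \<and> (height_step m ^^ t) h (i + 1) \<le> x + 1"
    by (auto simp: height_step_def[of m "(height_step m ^^ t) h"])
  also have "\<dots> \<longleftrightarrow> (\<forall>k\<le>t. ?a k \<le> x) \<and> (\<forall>k\<le>t. ?a (Suc k) \<le> x)"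
    unfolding Suc.IH e1 e2 by (auto simp: algebra_simps)
  also have "\<dots> \<longleftrightarrow> (\<forall>k\<in>{..t} \<union> Suc ` {..t}. ?a k \<le> x)"
    by blast
  also have "{..t} \<union> Suc ` {..t} = {..Suc t}"
    by (auto simp: image_Suc_atMost)
  finally show ?case unfolding Ball_def atMost_iff .
qed simp

lemma height_exists: "\<exists>h. is_height h s"
proof -
  \<comment> \<open>A signed count of cars from the origin; one of the two sums is always
    empty.\<close>
  define h :: "int \<Rightarrow> int" where
    "h i = (\<Sum>j\<in>{0<..i}. of_bool (s j)) - (\<Sum>j\<in>{i<..0}. of_bool (s j))" for i
  have "h (i + 1) = h i + of_bool (s (i + 1))" for i
  proof (cases "i \<ge> 0")
    case True
    hence "{0<..i + 1} = insert (i + 1) {0<..i}" by auto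
    thus ?thesis using True by (simp add: h_def)
  next
    case False
    hence "{i<..0} = insert (i + 1) {i + 1<..0}" by auto
    thus ?thesis using False by (simp add: h_def)
  qed
  thus ?thesis unfolding is_height_def by blast
qed

section \<open>Car counts and the criterion for a block of zeros\<close>

lemma ball_1_Suc_iff: "(\<forall>j\<in>{1..Suc n}. P j) \<longleftrightarrow> (\<forall>j\<le>n. P (Suc j))"
proof -
  have "{1..Suc n} = Suc ` {..n}" by (simp add: image_Suc_atMost)
  thus ?thesis by auto
qed

definition cars :: "(int \<Rightarrow> bool) \<Rightarrow> int \<Rightarrow> nat \<Rightarrow> nat" where
  "cars s i n = (\<Sum>k<n. of_bool (s (i + int k)))"

lemma cars_0 [simp]: "cars s i 0 = 0"
  by (simp add: cars_def)

lemma zeros_iff_cars_zero: "block_at s i (replicate n False) \<longleftrightarrow> cars s i n = 0"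
  unfolding block_at_def cars_def by auto

lemma height_cars:
  assumes "is_height h s"
  shows "h (i + int n) = h i + int (cars s (i + 1) n)"
  using height_add[OF assms] by (simp only: cars_def of_nat_sum of_nat_of_bool)

text \<open>Here \<open>H\<close> is the maximum of \<open>a 0, ..., a t\<close>. If all later
  values up to index \<open>t + 1\<close> are below \<open>H\<close>, the maximum can only be
  attained at index 0.\<close>

lemma unique_max_iff:
  fixes a :: "nat \<Rightarrow> int"
  assumes H: "\<And>x. H \<le> x \<longleftrightarrow> (\<forall>k\<le>t. a k \<le> x)"
  shows "(\<forall>k\<le>t. a (Suc k) \<le> H - 1) \<longleftrightarrow> (\<forall>k\<le>t. a (Suc k) < a 0)"
proof
  assume L: "\<forall>k\<le>t. a (Suc k) \<le> H - 1"
  have "\<not> H \<le> H - 1" by simp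
  then obtain k where k: "k \<le> t" "a k > H - 1" using H[of "H - 1"] by fastforce
  have "k = 0"
  proof (cases k)
    case (Suc l)
    hence "a (Suc l) \<le> H - 1" using L k(1) by simp
    thus ?thesis using k(2) Suc by simp
  qed
  thus "\<forall>k\<le>t. a (Suc k) < a 0" using L k by fastforce
next
  assume R: "\<forall>k\<le>t. a (Suc k) < a 0"
  have "a 0 \<le> H" using H[of H] by simp
  thus "\<forall>k\<le>t. a (Suc k) \<le> H - 1" using R by fastforce
qed

text \<open>The block is empty iff the height does not increase from site -1 to site
  \<open>m\<close>. These sites are \<open>m + 1\<close> apart, which is the spacing in the maximum
  formula, so both heights are maxima of one sequence \<open>?a\<close> over index ranges shifted by
  one.\<close>

lemma zero_block_iterate_iff:
  assumes m: "m \<ge> 1"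
  shows "block_at ((fi_step m ^^ t) s) 0 (replicate (m + 1) False) \<longleftrightarrow>
    (\<forall>j\<in>{1..t + 1}. cars s (- int (m * t)) ((m + 1) * j) < j)"
proof -
  obtain h where h: "is_height h s" using height_exists by blast
  let ?H = "(height_step m ^^ t) h"
  let ?a = "\<lambda>k::nat. h (-1 - int m * int t + (int m + 1) * int k) - int k"
  have "?H (-1 + int (m + 1)) = ?H (-1) + int (cars ((fi_step m ^^ t) s) 0 (m + 1))"
    using height_cars[OF height_fi_step_iterate[OF h m, of t], of "-1" "m + 1"] by simp
  hence "block_at ((fi_step m ^^ t) s) 0 (replicate (m + 1) False) \<longleftrightarrow> ?H (int m) \<le> ?H (-1)"
    unfolding zeros_iff_cars_zero by auto
  also have "\<dots> \<longleftrightarrow> (\<forall>k\<le>t. ?a (Suc k) \<le> ?H (-1) - 1)"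
  proof -
    \<comment> \<open>The \<open>+ 1\<close> below compensates for \<open>?a (Suc k)\<close>
      subtracting \<open>Suc k\<close> instead of \<open>k\<close>.\<close>
    have e: "int m - int m * int t + (int m + 1) * int k
        = -1 - int m * int t + (int m + 1) * int (Suc k)" for k
      by (simp add: algebra_simps)
    have "?H (int m) \<le> x \<longleftrightarrow> (\<forall>k\<le>t. ?a (Suc k) + 1 \<le> x)" for x
      unfolding height_step_iterate_le_iff[where m = m and t = t and i = "int m"] e
      by (simp add: algebra_simps)
    thus ?thesis by (simp only: le_diff_eq)
  qed
  also have "\<dots> \<longleftrightarrow> (\<forall>k\<le>t. ?a (Suc k) < ?a 0)"
    by (rule unique_max_iff) (rule height_step_iterate_le_iff)
  also have "\<dots> \<longleftrightarrow> (\<forall>k\<le>t. cars s (- int (m * t)) ((m + 1) * Suc k) < Suc k)"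
  proof -
    have "?a k = ?a 0 + int (cars s (- int (m * t)) ((m + 1) * k)) - int k" for k
      using height_cars[OF h, of "-1 - int m * int t" "(m + 1) * k"]
      by (simp add: algebra_simps)
    hence "?a k < ?a 0 \<longleftrightarrow> cars s (- int (m * t)) ((m + 1) * k) < k" for k
      by (smt (verit) of_nat_less_iff)
    thus ?thesis by (simp only:)
  qed
  also have "\<dots> \<longleftrightarrow> (\<forall>j\<in>{1..t + 1}. cars s (- int (m * t)) ((m + 1) * j) < j)"
    unfolding Suc_eq_plus1[symmetric] ball_1_Suc_iff ..
  finally show ?thesis .
qed

section \<open>The queue\<close>

text \<open>The truncated subtraction is the idling of the server: the queue stays empty if there is nobody
  to serve.\<close>

fun queue :: "nat \<Rightarrow> (int \<Rightarrow> bool) \<Rightarrow> nat \<Rightarrow> nat" where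
  "queue L s 0 = 0"
| "queue L s (Suc n) = queue L s n + cars s (int (L * n)) L - 1"

lemma all_le_Suc_iff: "(\<forall>j\<le>Suc n. P j) \<longleftrightarrow> P 0 \<and> (\<forall>j\<le>n. P (Suc j))"
  unfolding less_Suc_eq_le[symmetric] by (rule All_less_Suc2)

lemma cars_append: "cars s i (a + b) = cars s i a + cars s (i + int a) b"
  unfolding cars_def by (induction b) (simp_all add: algebra_simps del: sum_of_bool_eq)

lemma cars_blocks_Suc:
  assumes "j \<le> n"
  shows "cars s (int (L * (n - j))) (L * Suc j)
    = cars s (int (L * (n - j))) (L * j) + cars s (int (L * n)) L"
proof -
  have "int (L * (n - j)) + int (L * j) = int (L * n)"
    using assms by (metis add_mult_distrib2 le_add_diff_inverse2 of_nat_add)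
  thus ?thesis using cars_append[of s "int (L * (n - j))" "L * j" L]
    by (simp add: algebra_simps)
qed

text \<open>Lindley's recursion unrolled: the queue is the maximum over \<open>j\<close> of the
  arrivals in the last \<open>j\<close> slots minus \<open>j\<close>, where \<open>j = 0\<close>
  accounts for the truncation at 0.\<close>

lemma queue_le_iff:
  "queue L s n \<le> r \<longleftrightarrow> (\<forall>j\<le>n. cars s (int (L * (n - j))) (L * j) \<le> j + r)"
proof (induction n arbitrary: r)
  case (Suc n)
  let ?X = "cars s (int (L * n)) L"
  have "(\<forall>j\<le>Suc n. cars s (int (L * (Suc n - j))) (L * j) \<le> j + r) \<longleftrightarrow>
      (\<forall>j\<le>n. cars s (int (L * (n - j))) (L * Suc j) \<le> Suc j + r)"
    unfolding all_le_Suc_iff by simp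
  also have "\<dots> \<longleftrightarrow> (\<forall>j\<le>n. cars s (int (L * (n - j))) (L * j) + ?X \<le> Suc j + r)"
    using cars_blocks_Suc by auto
  also have "\<dots> \<longleftrightarrow> queue L s (Suc n) \<le> r"
  proof (cases "?X \<le> Suc r")
    \<comment> \<open>The induction hypothesis is applied to the bound \<open>Suc r - ?X\<close>,
      which is an exact difference only in this case.\<close>
    case True
    have "queue L s (Suc n) \<le> r \<longleftrightarrow> queue L s n \<le> Suc r - ?X" using True by auto
    also have "\<dots> \<longleftrightarrow> (\<forall>j\<le>n. cars s (int (L * (n - j))) (L * j) \<le> j + (Suc r - ?X))"
      by (rule Suc.IH)
    also have "\<dots> \<longleftrightarrow> (\<forall>j\<le>n. cars s (int (L * (n - j))) (L * j) + ?X \<le> Suc j + r)"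
    proof -
      have "a \<le> j + (Suc r - ?X) \<longleftrightarrow> a + ?X \<le> Suc j + r" for a j using True by linarith
      thus ?thesis by simp
    qed
    finally show ?thesis by simp
  next
    case False
    \<comment> \<open>The index \<open>j = 0\<close> already fails: the newest block alone overfills
      the queue.\<close>
    have "\<not> cars s (int (L * (n - 0))) (L * 0) + ?X \<le> Suc 0 + r" using False by simp
    moreover have "\<not> queue L s (Suc n) \<le> r" using False by simp
    ultimately show ?thesis by blast
  qed
  finally show ?case by simp
qed simp

text \<open>These are the inequalities of \<open>zero_block_iterate_iff\<close>, except that the
  windows share their right end instead of their left end.\<close>

lemma queue_empty_iff:
  "queue L s n + cars s (int (L * n)) L = 0 \<longleftrightarrow>
    (\<forall>j\<in>{1..Suc n}. cars s (int (L * (Suc n - j))) (L * j) < j)"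
proof -
  let ?X = "cars s (int (L * n)) L"
  have "(\<forall>j\<in>{1..Suc n}. cars s (int (L * (Suc n - j))) (L * j) < j) \<longleftrightarrow>
     (\<forall>j\<le>n. cars s (int (L * (n - j))) (L * Suc j) \<le> j)"
    unfolding ball_1_Suc_iff by (simp add: less_Suc_eq_le)
  also have "\<dots> \<longleftrightarrow> (\<forall>j\<le>n. cars s (int (L * (n - j))) (L * j) + ?X \<le> j)"
    using cars_blocks_Suc by auto
  also have "\<dots> \<longleftrightarrow> queue L s n \<le> 0 \<and> ?X = 0"
    unfolding queue_le_iff by fastforce
  finally show ?thesis by simp
qed

section \<open>Symmetry and locality of car counts, queues and the dynamics\<close>

lemma cars_reflect:
  "cars (\<lambda>i. s (c - i)) i n = cars s (c - i - int n + 1) n"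
  unfolding cars_def
  by (rule sum.reindex_bij_witness[of _ "\<lambda>j. n - 1 - j" "\<lambda>j. n - 1 - j"])
     (auto simp: of_nat_diff algebra_simps)

lemma cars_shift: "cars (\<lambda>i. s (i + c)) i n = cars s (i + c) n"
  by (simp add: cars_def algebra_simps)

lemma real_cars: "real (cars s i n) = (\<Sum>k<n. of_bool (s (i + int k)))"
  by (simp only: cars_def of_nat_sum of_nat_of_bool)

lemma cars_fun_upd: "k \<notin> {i..<i + int n} \<Longrightarrow> cars (s(k := b)) i n = cars s i n"
  unfolding cars_def by (intro sum.cong) auto

lemma cars_le: "cars s i n \<le> n"
  unfolding cars_def using sum_bounded_above[of "{..<n}" "\<lambda>k. of_bool (s (i + int k))" "1 :: nat"]
  by simp

text \<open>The queue has seen only sites below \<open>L * n\<close>. This is its independence of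
  the next arrivals, in the form that \<open>expectation_cars_mult\<close> requires.\<close>

lemma queue_fun_upd: "int (L * n) \<le> k \<Longrightarrow> queue L (s(k := b)) n = queue L s n"
proof (induction n)
  case (Suc n)
  have "k \<notin> {int (L * n)..<int (L * n) + int L}" using Suc.prems by (simp add: algebra_simps)
  moreover have "int (L * n) \<le> k" using Suc.prems by (simp add: algebra_simps)
  ultimately show ?case using Suc.IH by (simp only: queue.simps cars_fun_upd not_False_eq_True)
qed simp

text \<open>A crude bound, enough to make the moments of the queue length integrable.\<close>

lemma queue_le: "queue L s n \<le> L * n"
proof (induction n)
  case (Suc n)
  thus ?case using cars_le[of s "int (L * n)" L] by (simp add: add_mono)
qed simp

lemma fi_step_shift: "fi_step m (\<lambda>i. s (i + c)) = (\<lambda>i. fi_step m s (i + c))"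
  by (simp add: fi_step_def fun_eq_iff algebra_simps)

lemma fi_step_iterate_shift:
  "(fi_step m ^^ t) (\<lambda>i. s (i + c)) = (\<lambda>i. (fi_step m ^^ t) s (i + c))"
  by (induction t) (simp_all add: fi_step_shift)

lemma block_at_Cons: "block_at s i (x # B) \<longleftrightarrow> s i = x \<and> block_at s (i + 1) B"
  unfolding block_at_def by (simp add: All_less_Suc2 algebra_simps)

lemma block_at_append:
  "block_at s i (A @ B) \<longleftrightarrow> block_at s i A \<and> block_at s (i + int (length A)) B"
proof (induction A arbitrary: i)
  case Nil
  show ?case by (simp add: block_at_def)
next
  case (Cons a A)
  show ?case by (simp add: block_at_Cons Cons.IH add.assoc)
qed

lemma crosses_shift: "crosses m (\<lambda>i. s (i + c)) i = crosses m s (i + c)"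
proof -
  have "i + 1 + c = i + c + 1" "i - int j + c = i + c - int j" for j by simp_all
  thus ?thesis unfolding crosses_def by (simp only:)
qed

text \<open>Abel summation for the flow: \<open>b k\<close> will be the probability of a car
  followed by \<open>k\<close> empty sites, so that \<open>b k - b (Suc k)\<close> is that of a gap
  of exactly \<open>k\<close>.\<close>

lemma sum_by_parts:
  "(\<Sum>k = 1..n. real k * (b k - b (Suc k))) + real (Suc n) * b (Suc n) = (\<Sum>k = 1..Suc n. b k)"
proof (induction n)
  case 0
  show ?case by simp
next
  case (Suc n)
  show ?case using Suc by (simp add: algebra_simps)
qed

text \<open>The difference \<open>v n - (w n)\<^sup>2\<close> is a variance, and the recursions make it grow by at most
  \<open>c - 2 * w n * q n\<close> per step. If the limit \<open>p\<close> of \<open>q\<close> and the growth rate \<open>p + \<nu>\<close> of \<open>w\<close> were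
  both positive, it would become negative.\<close>

lemma tendsto_of_drift_variance:
  fixes w v q :: "nat \<Rightarrow> real"
  assumes w0: "w 0 = 0" and v0: "v 0 = 0"
    and w_Suc: "\<And>n. w (Suc n) = w n + \<nu> + q n"
    and v_Suc: "\<And>n. v (Suc n) \<le> v n + 2 * \<nu> * w n + c"
    and var: "\<And>n. (w n)\<^sup>2 \<le> v n" and w_nonneg: "\<And>n. 0 \<le> w n"
    and q_nonneg: "\<And>n. 0 \<le> q n" and q_dec: "decseq q"
  shows "q \<longlonglongrightarrow> max 0 (- \<nu>)"
proof -
  obtain p where p: "q \<longlonglongrightarrow> p" "\<And>n. p \<le> q n"
    using decseq_convergent[OF q_dec, of 0] q_nonneg by blast
  have p0: "0 \<le> p" using p(1) q_nonneg by (intro LIMSEQ_le_const) auto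
  \<comment> \<open>Otherwise, since \<open>q\<close> decreases, \<open>w\<close> would lose at
    least a fixed positive amount per step from \<open>N\<close> on and become negative.\<close>
  have "- \<nu> \<le> q N" for N
  proof (rule ccontr)
    assume neg: "\<not> - \<nu> \<le> q N"
    have "w (N + k) \<le> w N + real k * (q N + \<nu>)" for k
    proof (induction k)
      case (Suc k)
      have "q (N + k) \<le> q N" using q_dec by (simp add: decseqD)
      thus ?case using Suc w_Suc[of "N + k"] by (simp add: algebra_simps)
    qed simp
    moreover obtain k where "w N < real k * - (q N + \<nu>)"
      using neg reals_Archimedean3[of "- (q N + \<nu>)"] by auto
    ultimately show False using w_nonneg[of "N + k"] by (smt (verit) mult_minus_right)
  qed
  hence "- \<nu> \<le> p" using p(1) by (intro LIMSEQ_le_const[of q]) auto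
  have w_ge: "real n * (p + \<nu>) \<le> w n" for n
  proof (induction n)
    case (Suc n)
    thus ?case using w_Suc[of n] p(2)[of n] by (simp add: algebra_simps)
  qed (simp add: w0)
  define e where "e = p * (p + \<nu>)"
  have "e \<le> 0"
  proof (rule ccontr)
    assume "\<not> e \<le> 0"
    \<comment> \<open>Each increment is at most \<open>c - 2 * real n * e\<close>; summing
      \<open>2 * real k * e\<close> over \<open>k < n\<close> gives the quadratic term.\<close>
    have d: "v n - (w n)\<^sup>2 \<le> c * real n - e * real n * (real n - 1)" for n
    proof (induction n)
      case (Suc n)
      have "real n * e \<le> w n * q n"
        using mult_mono[OF w_ge[of n] p(2)[of n] w_nonneg p0] by (simp add: e_def mult_ac)
      moreover have "(w (Suc n))\<^sup>2 \<ge> (w n)\<^sup>2 + 2 * w n * (\<nu> + q n)"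
      proof -
        have "(w (Suc n))\<^sup>2 = (w n)\<^sup>2 + 2 * w n * (\<nu> + q n) + (\<nu> + q n)\<^sup>2"
          unfolding w_Suc by (simp add: power2_eq_square algebra_simps)
        thus ?thesis by simp
      qed
      ultimately show ?case using Suc v_Suc[of n] by (simp add: algebra_simps)
    qed (simp add: w0 v0)
    \<comment> \<open>At index \<open>Suc n\<close> the bound \<open>d\<close> equals
      \<open>real (Suc n) * (c - real n * e)\<close>, negative for this \<open>n\<close>.\<close>
    obtain n where n: "c < real n * e" using \<open>\<not> e \<le> 0\<close> reals_Archimedean3[of e] by auto
    have "real (Suc n) - 1 = real n" by simp
    hence "0 \<le> c * real (Suc n) - e * real (Suc n) * real n"
      using d[of "Suc n"] var[of "Suc n"] by (simp only:)
    hence "0 \<le> real (Suc n) * (c - real n * e)" by (simp add: algebra_simps)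
    thus False using n by (simp add: zero_le_mult_iff)
  qed
  hence "p = 0 \<or> p + \<nu> = 0"
    using p0 \<open>- \<nu> \<le> p\<close> unfolding e_def by (smt (verit) mult_pos_pos)
  hence "p = max 0 (- \<nu>)" using p0 \<open>- \<nu> \<le> p\<close> by auto
  thus ?thesis using p by simp
qed

section \<open>Random configurations\<close>

locale bernoulli_road =
  fixes \<rho> :: real
  assumes rho: "0 \<le> \<rho>" "\<rho> \<le> 1"
begin

sublocale prob_space "bernoulli_config \<rho>"
  unfolding bernoulli_config_def by (intro prob_space_PiM measure_pmf.prob_space_axioms)

lemma space_config [simp]: "space (bernoulli_config \<rho>) = UNIV"
  unfolding bernoulli_config_def by (simp add: space_PiM)

lemma measurable_site [measurable]: "Measurable.pred (bernoulli_config \<rho>) (\<lambda>s. s i)"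
  using measurable_fi_step_iterate[where m = 0 and t = 0] by simp

lemma measurable_cars [measurable]:
  assumes "\<And>i. Measurable.pred (bernoulli_config \<rho>) (\<lambda>s. f s i)"
  shows "(\<lambda>s. cars (f s) i n) \<in> measurable (bernoulli_config \<rho>) (count_space UNIV)"
proof -
  note [measurable] = assms
  show ?thesis unfolding cars_def by measurable
qed

lemma measurable_queue [measurable]:
  "(\<lambda>s. queue L s n) \<in> measurable (bernoulli_config \<rho>) (count_space UNIV)"
  by (induction n) simp_all

text \<open>The sites are i.i.d., so injective relabelling preserves the law. Both translations and
  reflections are instances.\<close>

lemma distr_reindex:
  assumes "inj f"
  shows "distr (bernoulli_config \<rho>) (bernoulli_config \<rho>) (\<lambda>s i. s (f i)) = bernoulli_config \<rho>"
  using distr_PiM_reindex[of UNIV "\<lambda>_. measure_pmf (bernoulli_pmf \<rho>)" f UNIV] assms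
  unfolding bernoulli_config_def by (simp add: measure_pmf.prob_space_axioms restrict_def)

lemma measurable_reindex [measurable]:
  "(\<lambda>s i. s (f i)) \<in> measurable (bernoulli_config \<rho>) (bernoulli_config \<rho>)"
proof -
  have "(\<lambda>s. s j) \<in> measurable (bernoulli_config \<rho>) (measure_pmf (bernoulli_pmf \<rho>))" for j
    unfolding bernoulli_config_def by (rule measurable_component_singleton) simp
  thus ?thesis
    by (subst (2) bernoulli_config_def) (intro measurable_PiM_single', auto)
qed

lemma prob_reindex:
  assumes "inj f" and [measurable]: "Measurable.pred (bernoulli_config \<rho>) Q"
  shows "\<P>(s in bernoulli_config \<rho>. Q (\<lambda>i. s (f i))) = \<P>(s in bernoulli_config \<rho>. Q s)"
proof -
  have "\<P>(s in bernoulli_config \<rho>. Q s)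
      = measure (distr (bernoulli_config \<rho>) (bernoulli_config \<rho>) (\<lambda>s i. s (f i))) {s. Q s}"
    by (simp add: distr_reindex assms)
  also have "\<dots> = \<P>(s in bernoulli_config \<rho>. Q (\<lambda>i. s (f i)))"
    using assms(2) by (subst measure_distr) (auto simp: vimage_def pred_def)
  finally show ?thesis by simp
qed

section \<open>Expectations and independence of sites\<close>

lemma integrable_bounded:
  fixes F :: "(int \<Rightarrow> bool) \<Rightarrow> real"
  assumes "F \<in> borel_measurable (bernoulli_config \<rho>)" "\<And>s. \<bar>F s\<bar> \<le> B"
  shows "integrable (bernoulli_config \<rho>) F"
  using assms by (intro integrable_const_bound[of _ B]) auto

lemma expectation_of_bool:
  "expectation (\<lambda>s. of_bool (Q s)) = \<P>(s in bernoulli_config \<rho>. Q s)"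
proof -
  have "(\<lambda>s. of_bool (Q s)) = (indicator {s. Q s} :: _ \<Rightarrow> real)"
    by (auto simp: indicator_def)
  thus ?thesis by simp
qed

text \<open>Independence is expressed as invariance of \<open>F\<close> under changing site
  \<open>i\<close>. The measure splits into site \<open>i\<close> and the rest, and Fubini separates
  the two factors.\<close>

lemma expectation_site_mult:
  fixes F :: "(int \<Rightarrow> bool) \<Rightarrow> real"
  assumes F [measurable]: "F \<in> borel_measurable (bernoulli_config \<rho>)" and B: "\<And>s. \<bar>F s\<bar> \<le> B"
    and indep: "\<And>s b. F (s(i := b)) = F s"
  shows "expectation (\<lambda>s. of_bool (s i) * F s) = \<rho> * expectation F"
proof -
  let ?b = "measure_pmf (bernoulli_pmf \<rho>)"
  let ?P = "\<Pi>\<^sub>M j\<in>UNIV - {i}. ?b"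
  let ?M = "bernoulli_config \<rho>"
  interpret P: prob_space ?P by (intro prob_space_PiM measure_pmf.prob_space_axioms)
  interpret bP: pair_prob_space ?b ?P ..
  have ins: "insert i (UNIV - {i}) = (UNIV :: int set)" by auto
  have M: "distr (?b \<Otimes>\<^sub>M ?P) ?M (\<lambda>(x, X). X(i := x)) = ?M"
    using distr_pair_PiM_eq_PiM[of "UNIV - {i}" "\<lambda>_. ?b" i]
    unfolding ins bernoulli_config_def by (simp add: measure_pmf.prob_space_axioms)
  have upd: "(\<lambda>(x, X). X(i := x)) \<in> measurable (?b \<Otimes>\<^sub>M ?P) ?M"
    unfolding bernoulli_config_def case_prod_unfold
    by (rule measurable_fun_upd[of _ "UNIV - {i}"]) (use ins in \<open>auto intro: measurable_snd measurable_fst\<close>)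
  have upd0: "(\<lambda>X. X(i := False)) \<in> measurable ?P ?M"
    unfolding bernoulli_config_def
    by (rule measurable_fun_upd[of _ "UNIV - {i}"]) (use ins in auto)
  \<comment> \<open>Freezing site \<open>i\<close> at \<open>False\<close> changes nothing, because
    \<open>F\<close> ignores that site.\<close>
  define c where "c = (\<integral>X. F (X(i := False)) \<partial>?P)"
  \<comment> \<open>Two choices of \<open>g\<close> suffice: \<open>of_bool\<close> produces
    \<open>\<rho> * c\<close>, and the constant 1 identifies \<open>c\<close> as the expectation of
    \<open>F\<close>.\<close>
  have key: "expectation (\<lambda>s. g (s i) * F s) = (\<integral>x. g x \<partial>?b) * c"
    if g: "\<And>x. \<bar>g x\<bar> \<le> 1" for g :: "bool \<Rightarrow> real"
  proof -
    have meas: "(\<lambda>(x, X). g x * F (X(i := False))) \<in> borel_measurable (?b \<Otimes>\<^sub>M ?P)"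
      unfolding case_prod_unfold
    proof (rule borel_measurable_times)
      show "(\<lambda>z. g (fst z)) \<in> borel_measurable (?b \<Otimes>\<^sub>M ?P)"
        by (rule measurable_compose[OF measurable_fst]) simp
      show "(\<lambda>z. F ((snd z)(i := False))) \<in> borel_measurable (?b \<Otimes>\<^sub>M ?P)"
        by (rule measurable_compose[OF measurable_snd]) (rule measurable_compose[OF upd0 F])
    qed
    have gm: "(\<lambda>s. g (s i)) \<in> borel_measurable ?M"
      by (rule measurable_compose[OF measurable_site]) simp
    have "expectation (\<lambda>s. g (s i) * F s)
        = (\<integral>s. g (s i) * F s \<partial>distr (?b \<Otimes>\<^sub>M ?P) ?M (\<lambda>(x, X). X(i := x)))"
      by (simp only: M)
    also have "\<dots> = (\<integral>z. (case z of (x, X) \<Rightarrow> g x * F (X(i := False))) \<partial>(?b \<Otimes>\<^sub>M ?P))"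
    proof (subst integral_distr[OF upd])
      have "F (X(i := x)) = F (X(i := False))" for X x
        using indep[of "X(i := x)" False] by simp
      thus "(\<integral>z. g ((case z of (x, X) \<Rightarrow> X(i := x)) i) * F (case z of (x, X) \<Rightarrow> X(i := x))
          \<partial>(?b \<Otimes>\<^sub>M ?P)) = (\<integral>z. (case z of (x, X) \<Rightarrow> g x * F (X(i := False))) \<partial>(?b \<Otimes>\<^sub>M ?P))"
        by (intro Bochner_Integration.integral_cong) auto
    qed (intro borel_measurable_times gm F)
    also have "\<dots> = (\<integral>x. (\<integral>X. g x * F (X(i := False)) \<partial>?P) \<partial>?b)"
    proof (rule bP.integral_fst[symmetric], rule bP.integrable_const_bound[of _ B])
      have "\<bar>g x * F X\<bar> \<le> B" for x X
        using mult_mono[OF g[of x] B[of X]] by (simp add: abs_mult)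
      thus "AE z in ?b \<Otimes>\<^sub>M ?P. norm (case z of (x, X) \<Rightarrow> g x * F (X(i := False))) \<le> B"
        by auto
    qed (rule meas)
    also have "\<dots> = (\<integral>x. g x \<partial>?b) * c" by (simp add: c_def)
    finally show ?thesis .
  qed
  show ?thesis using key[of of_bool] key[of "\<lambda>_. 1"] rho by simp
qed

lemma prob_site: "\<P>(s in bernoulli_config \<rho>. s i) = \<rho>"
  using expectation_site_mult[of "\<lambda>_. 1" 1 i] expectation_of_bool[of "\<lambda>s. s i"]
  by (simp add: prob_space[unfolded space_config])

lemma expectation_cars_mult:
  fixes F :: "(int \<Rightarrow> bool) \<Rightarrow> real"
  assumes F [measurable]: "F \<in> borel_measurable (bernoulli_config \<rho>)" and B: "\<And>s. \<bar>F s\<bar> \<le> B"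
    and indep: "\<And>s k b. k \<ge> i \<Longrightarrow> F (s(k := b)) = F s"
  shows "expectation (\<lambda>s. real (cars s i n) * F s) = real n * \<rho> * expectation F"
proof -
  have "integrable (bernoulli_config \<rho>) (\<lambda>s. of_bool (s k) * F s)" for k
  proof (rule integrable_bounded)
    show "\<bar>of_bool (s k) * F s\<bar> \<le> B" for s
      using B[of s] by (cases "s k") auto
  qed measurable
  hence "expectation (\<lambda>s. real (cars s i n) * F s)
      = (\<Sum>k<n. expectation (\<lambda>s. of_bool (s (i + int k)) * F s))"
    by (simp add: real_cars sum_distrib_right del: sum_of_bool_eq sum_of_bool_mult_eq)
  also have "\<dots> = (\<Sum>k<n. \<rho> * expectation F)"
    by (intro sum.cong refl expectation_site_mult[OF F B] indep) auto
  finally show ?thesis by simp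
qed

subsection \<open>The idle probability\<close>

abbreviation idle_prob :: "nat \<Rightarrow> nat \<Rightarrow> real" where
  "idle_prob L n \<equiv> \<P>(s in bernoulli_config \<rho>. queue L s n + cars s (int (L * n)) L = 0)"

text \<open>Reflection about the middle of the first \<open>Suc n\<close> blocks preserves the law
  and turns windows with a common right end into windows starting at 0. In this form the events are
  nested in \<open>n\<close>.\<close>

lemma idle_prob_eq:
  "idle_prob L n = \<P>(s in bernoulli_config \<rho>. \<forall>j\<in>{1..Suc n}. cars s 0 (L * j) < j)"
proof -
  let ?c = "int (L * Suc n) - 1"
  let ?Q = "\<lambda>s. \<forall>j\<in>{1..Suc n}. cars s (int (L * (Suc n - j))) (L * j) < j"
  have "cars (\<lambda>i. s (?c - i)) (int (L * (Suc n - j))) (L * j) = cars s 0 (L * j)"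
    if "j \<in> {1..Suc n}" for s j
  proof -
    have "int (L * (Suc n - j)) + int (L * j) = int (L * Suc n)"
      using that by (metis add_mult_distrib2 atLeastAtMost_iff le_add_diff_inverse2 of_nat_add)
    thus ?thesis unfolding cars_reflect by (intro arg_cong2[of _ _ _ _ "cars s"]) auto
  qed
  hence "?Q (\<lambda>i. s (?c - i)) \<longleftrightarrow> (\<forall>j\<in>{1..Suc n}. cars s 0 (L * j) < j)" for s
    by (intro ball_cong) auto
  moreover have "\<P>(s in bernoulli_config \<rho>. ?Q (\<lambda>i. s (?c - i))) = \<P>(s in bernoulli_config \<rho>. ?Q s)"
    by (rule prob_reindex) (auto simp: inj_def)
  ultimately show ?thesis unfolding queue_empty_iff by simp
qed

text \<open>Translation invariance absorbs the offset \<open>- int (m * t)\<close>; time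
  \<open>t\<close> corresponds to slot \<open>t\<close> counted from 0.\<close>

lemma block_prob_zeros_eq_idle_prob:
  assumes "m \<ge> 1"
  shows "block_prob m \<rho> t (replicate (m + 1) False) = idle_prob (m + 1) t"
proof -
  let ?c = "- int (m * t)"
  let ?Q = "\<lambda>s. \<forall>j\<in>{1..Suc t}. cars s 0 ((m + 1) * j) < j"
  have "?Q (\<lambda>i. s (i + ?c)) \<longleftrightarrow> (\<forall>j\<in>{1..t + 1}. cars s ?c ((m + 1) * j) < j)" for s
    unfolding cars_shift by simp
  moreover have "\<P>(s in bernoulli_config \<rho>. ?Q (\<lambda>i. s (i + ?c))) = \<P>(s in bernoulli_config \<rho>. ?Q s)"
    by (rule prob_reindex) (auto simp: inj_def)
  ultimately show ?thesis
    unfolding block_prob_def zero_block_iterate_iff[OF assms] idle_prob_eq by simp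
qed

lemma idle_prob_decseq: "decseq (idle_prob L)"
proof (rule decseq_SucI)
  fix n
  show "idle_prob L (Suc n) \<le> idle_prob L n"
    unfolding idle_prob_eq
  proof (rule finite_measure_mono)
    have "Measurable.pred (bernoulli_config \<rho>) (\<lambda>s. \<forall>j\<in>{1..Suc n}. cars s 0 (L * j) < j)"
      by measurable
    thus "{s \<in> space (bernoulli_config \<rho>). \<forall>j\<in>{1..Suc n}. cars s 0 (L * j) < j} \<in> events"
      by (simp add: pred_def)
  qed auto
qed

lemma idle_prob_tendsto:
  assumes "L \<ge> 1"
  shows "idle_prob L \<longlonglongrightarrow> max 0 (1 - real L * \<rho>)"
proof -
  define W where "W n s = real (queue L s n)" for n s
  define X where "X n s = real (cars s (int (L * n)) L)" for n s
  define I where "I n s = (of_bool (queue L s n + cars s (int (L * n)) L = 0) :: real)" for n s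
  have [measurable]: "W n \<in> borel_measurable (bernoulli_config \<rho>)"
    "X n \<in> borel_measurable (bernoulli_config \<rho>)"
    "I n \<in> borel_measurable (bernoulli_config \<rho>)" for n
    unfolding W_def X_def I_def by measurable
  have bounds: "0 \<le> W n s" "W n s \<le> real (L * n)" "0 \<le> X n s" "X n s \<le> real L" for n s
    unfolding W_def X_def using queue_le cars_le by (simp_all flip: of_nat_mult)
  have int: "integrable (bernoulli_config \<rho>) (W n)"
    "integrable (bernoulli_config \<rho>) (\<lambda>s. (W n s)\<^sup>2)"
    "integrable (bernoulli_config \<rho>) (X n)"
    "integrable (bernoulli_config \<rho>) (\<lambda>s. X n s * W n s)"
    "integrable (bernoulli_config \<rho>) (I n)" for n
  proof -
    show "integrable (bernoulli_config \<rho>) (W n)"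
      by (rule integrable_bounded[of _ "real (L * n)"]) (use bounds in auto)
    show "integrable (bernoulli_config \<rho>) (\<lambda>s. (W n s)\<^sup>2)"
      by (rule integrable_bounded[of _ "(real (L * n))\<^sup>2"])
         (use bounds in \<open>auto intro!: power_mono simp del: of_nat_mult\<close>)
    show "integrable (bernoulli_config \<rho>) (X n)"
      by (rule integrable_bounded[of _ "real L"]) (use bounds in auto)
    show "integrable (bernoulli_config \<rho>) (\<lambda>s. X n s * W n s)"
      by (rule integrable_bounded[of _ "real L * real (L * n)"])
         (use bounds in \<open>auto intro!: mult_mono simp: abs_mult simp del: of_nat_mult\<close>)
    show "integrable (bernoulli_config \<rho>) (I n)"
      by (rule integrable_bounded[of _ 1]) (auto simp: I_def)
  qed
  have one: "expectation (\<lambda>_. c) = c" for c :: real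
    by (simp add: prob_space[unfolded space_config])
  have EI: "expectation (I n) = idle_prob L n" for n
    unfolding I_def by (rule expectation_of_bool)
  have EX: "expectation (X n) = real L * \<rho>" for n
    using expectation_cars_mult[of "\<lambda>_. 1" 1 "int (L * n)" L] one[of 1]
    unfolding X_def by simp
  have EXW: "expectation (\<lambda>s. X n s * W n s) = real L * \<rho> * expectation (W n)" for n
    unfolding X_def
    by (rule expectation_cars_mult[of _ "real (L * n)"]) (use bounds in \<open>auto simp: W_def queue_fun_upd\<close>)
  \<comment> \<open>\<open>I\<close> gives back the unit that truncated subtraction does not remove
    when there is nobody to serve.\<close>
  have W_Suc: "W (Suc n) s = W n s + X n s - 1 + I n s" for n s
    unfolding W_def X_def I_def by (auto simp: of_nat_diff)
  define w where "w n = expectation (W n)" for n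
  define v where "v n = expectation (\<lambda>s. (W n s)\<^sup>2)" for n
  have "idle_prob L \<longlonglongrightarrow> max 0 (- (real L * \<rho> - 1))"
  \<comment> \<open>The drift is the mean number of arrivals minus one departure, and
    \<open>c\<close> bounds the square of \<open>X n s - 1\<close>.\<close>
  proof (rule tendsto_of_drift_variance[where w = w and v = v and c = "(real L)\<^sup>2"])
    have "W 0 = (\<lambda>_. 0)" by (simp add: W_def fun_eq_iff)
    thus "w 0 = 0" "v 0 = 0" by (simp_all add: w_def v_def)
    show "w (Suc n) = w n + (real L * \<rho> - 1) + idle_prob L n" for n
    proof -
      have "w (Suc n) = expectation (\<lambda>s. W n s + X n s - 1 + I n s)"
        unfolding w_def W_Suc ..
      also have "\<dots> = w n + (real L * \<rho> - 1) + idle_prob L n"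
        using int by (simp add: w_def EX EI one prob_space[unfolded space_config])
      finally show ?thesis .
    qed
    show "v (Suc n) \<le> v n + 2 * (real L * \<rho> - 1) * w n + (real L)\<^sup>2" for n
    proof -
      have "(W (Suc n) s)\<^sup>2 \<le> (W n s)\<^sup>2 + 2 * (X n s * W n s) - 2 * W n s + (real L)\<^sup>2" for s
      proof -
        \<comment> \<open>Equality holds when the server works; when it idles, the left side is
          0.\<close>
        have "(W (Suc n) s)\<^sup>2 \<le> (W n s + (X n s - 1))\<^sup>2"
        proof (cases "I n s = 0")
          case True
          thus ?thesis by (simp add: W_Suc algebra_simps)
        next
          case False
          hence "W (Suc n) s = 0" by (auto simp: W_def I_def split: if_splits)
          thus ?thesis by simp
        qed
        also have "\<dots> = (W n s)\<^sup>2 + 2 * (X n s * W n s) - 2 * W n s + (X n s - 1)\<^sup>2"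
          by (simp add: power2_eq_square algebra_simps)
        also have "(X n s - 1)\<^sup>2 \<le> (real L)\<^sup>2"
          using bounds(3,4)[of n s] assms by (intro abs_le_square_iff[THEN iffD1]) auto
        finally show ?thesis by simp
      qed
      hence "v (Suc n) \<le> expectation (\<lambda>s. (W n s)\<^sup>2 + 2 * (X n s * W n s) - 2 * W n s + (real L)\<^sup>2)"
        unfolding v_def using int
        by (intro integral_mono) (auto intro!: Bochner_Integration.integrable_diff Bochner_Integration.integrable_add)
      also have "\<dots> = v n + 2 * expectation (\<lambda>s. X n s * W n s) - 2 * w n + (real L)\<^sup>2"
        using int by (simp add: v_def w_def prob_space[unfolded space_config])
      also have "\<dots> = v n + 2 * (real L * \<rho> - 1) * w n + (real L)\<^sup>2"
        unfolding EXW w_def by (simp add: algebra_simps)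
      finally show ?thesis .
    qed
    show "(w n)\<^sup>2 \<le> v n" for n
      using variance_positive[of "W n"] variance_eq[OF int(1) int(2)] unfolding w_def v_def by simp
    show "0 \<le> w n" for n
      unfolding w_def using bounds(1) by simp
    show "decseq (idle_prob L)" by (rule idle_prob_decseq)
  qed simp
  thus ?thesis by (simp add: algebra_simps)
qed

subsection \<open>Stationarity and flow\<close>

lemma pred_crosses:
  "Measurable.pred (bernoulli_config \<rho>) (\<lambda>s. crosses m ((fi_step m ^^ t) s) i)"
proof -
  have "crosses m ((fi_step m ^^ t) s) i \<longleftrightarrow> \<not> (fi_step m ^^ t) s (i + 1)
      \<and> (\<exists>j\<in>{..<m}. (fi_step m ^^ t) s (i - int j))" for s
    unfolding crosses_def by auto
  thus ?thesis
    by (simp only:) (intro pred_intros_logic pred_intros_finite measurable_fi_step_iterate finite_lessThan)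
qed

lemma pred_cars_eq_0:
  "Measurable.pred (bernoulli_config \<rho>) (\<lambda>s. cars ((fi_step m ^^ t) s) i k = 0)"
  using block_event_measurable[where m = m and t = t and i = i and B = "replicate k False"]
  by (simp only: pred_def zeros_iff_cars_zero)

lemma prob_conj_eq_diff:
  assumes "Measurable.pred (bernoulli_config \<rho>) P" "Measurable.pred (bernoulli_config \<rho>) Q"
  shows "\<P>(s in bernoulli_config \<rho>. P s \<and> Q s)
    = \<P>(s in bernoulli_config \<rho>. Q s) - \<P>(s in bernoulli_config \<rho>. \<not> P s \<and> Q s)"
proof -
  have "{s. P s \<and> Q s} \<in> events" "{s. \<not> P s \<and> Q s} \<in> events"
    using pred_intros_logic(3)[OF assms] pred_intros_logic(3)[OF pred_intros_logic(2)[OF assms(1)] assms(2)]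
    by (simp_all add: pred_def)
  hence "prob ({s. P s \<and> Q s} \<union> {s. \<not> P s \<and> Q s}) = prob {s. P s \<and> Q s} + prob {s. \<not> P s \<and> Q s}"
    by (intro finite_measure_Union) auto
  moreover have "{s. P s \<and> Q s} \<union> {s. \<not> P s \<and> Q s} = {s. Q s}" by auto
  ultimately show ?thesis by simp
qed

text \<open>The rule commutes with translations, so the law stays translation invariant at all
  times.\<close>

lemma prob_iterate_shift:
  assumes "Measurable.pred (bernoulli_config \<rho>) (\<lambda>s. Q ((fi_step m ^^ t) s))"
  shows "\<P>(s in bernoulli_config \<rho>. Q (\<lambda>i. (fi_step m ^^ t) s (i + c)))
    = \<P>(s in bernoulli_config \<rho>. Q ((fi_step m ^^ t) s))"
proof -
  have "inj (\<lambda>i. i + c)" by (simp add: inj_def)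
  from prob_reindex[OF this assms] show ?thesis unfolding fi_step_iterate_shift .
qed

text \<open>Taking expectations in \<open>fi_step_conservation\<close>, the currents into and out of
  a site have equal mean by translation invariance and cancel.\<close>

lemma prob_iterate_site:
  assumes "m \<ge> 1"
  shows "\<P>(s in bernoulli_config \<rho>. (fi_step m ^^ t) s i) = \<rho>"
proof (induction t)
  case 0
  show ?case using prob_site by simp
next
  case (Suc t)
  have int: "integrable (bernoulli_config \<rho>) (\<lambda>s. of_bool (Q s) :: real)"
    if "Measurable.pred (bernoulli_config \<rho>) Q" for Q
  proof (rule integrable_bounded[of _ 1])
    show "(\<lambda>s. of_bool (Q s) :: real) \<in> borel_measurable (bernoulli_config \<rho>)"
      by (rule measurable_compose[OF that]) simp
  qed simp
  let ?u = "\<lambda>s. (fi_step m ^^ t) s"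
  have "expectation (\<lambda>s. of_bool (fi_step m (?u s) i) + of_bool (crosses m (?u s) i) :: real)
      = expectation (\<lambda>s. of_bool (?u s i) + of_bool (crosses m (?u s) (i - 1)))"
    by (simp only: fi_step_conservation[OF assms])
  hence "expectation (\<lambda>s. of_bool (fi_step m (?u s) i)) + expectation (\<lambda>s. of_bool (crosses m (?u s) i))
      = expectation (\<lambda>s. of_bool (?u s i) :: real) + expectation (\<lambda>s. of_bool (crosses m (?u s) (i - 1)))"
    by (subst (asm) (1 2) Bochner_Integration.integral_add)
       (use int[OF measurable_fi_step_iterate[where t = "Suc t"]] in
         \<open>auto intro!: int measurable_fi_step_iterate pred_crosses\<close>)
  moreover have "\<P>(s in bernoulli_config \<rho>. crosses m (?u s) (i - 1))
      = \<P>(s in bernoulli_config \<rho>. crosses m (?u s) i)"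
    using prob_iterate_shift[where Q = "\<lambda>u. crosses m u i" and m = m and t = t and c = "-1",
      OF pred_crosses]
    unfolding crosses_shift by simp
  ultimately show ?case using Suc unfolding expectation_of_bool by simp
qed

text \<open>Splitting on the site before or after a run of zeros expresses every block probability
  through the probabilities \<open>z k\<close> of \<open>k\<close> zeros. Summation by parts and
  telescoping leave \<open>z 1 - z (m + 1)\<close>, and \<open>z 1\<close> is
  \<open>1 - \<rho>\<close> by conservation of density.\<close>

lemma flow_eq:
  assumes m: "m \<ge> 1"
  shows "flow m \<rho> t = 1 - \<rho> - block_prob m \<rho> t (replicate (m + 1) False)"
proof -
  let ?u = "\<lambda>s. (fi_step m ^^ t) s"
  define z where "z k = block_prob m \<rho> t (replicate k False)" for k
  define b where "b k = block_prob m \<rho> t ([True] @ replicate k False)" for k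
  \<comment> \<open>The starting site \<open>i\<close> is left free: the zeros after a car at 0
    start at site 1, those of \<open>z (Suc k)\<close> at site 0.\<close>
  have z: "z k = \<P>(s in bernoulli_config \<rho>. cars (?u s) i k = 0)" for k i
    using prob_iterate_shift[where Q = "\<lambda>u. cars u 0 k = 0" and m = m and t = t and c = i,
      OF pred_cars_eq_0]
    unfolding z_def block_prob_def zeros_iff_cars_zero cars_shift by simp
  have cars_Cons: "cars u i (Suc k) = of_bool (u i) + cars u (i + 1) k" for u i k
    using cars_append[of u i 1 k] by (simp add: cars_def)
  have cars_Suc: "cars u i (Suc k) = cars u i k + of_bool (u (i + int k))" for u i k
    by (simp add: cars_def del: sum_of_bool_eq)
  have block1: "block_at u 0 ([True] @ replicate k False) \<longleftrightarrow> u 0 \<and> cars u 1 k = 0" for u k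
    by (simp add: block_at_Cons zeros_iff_cars_zero)
  have block2: "block_at u 0 ([True] @ replicate k False @ [True])
      \<longleftrightarrow> u (1 + int k) \<and> u 0 \<and> cars u 1 k = 0" for u k
    by (auto simp: block_at_Cons block_at_append zeros_iff_cars_zero block_at_def[of _ _ "[]"])
  have b: "b k = z k - z (Suc k)" for k
  proof -
    have "b k = \<P>(s in bernoulli_config \<rho>. ?u s 0 \<and> cars (?u s) 1 k = 0)"
      unfolding b_def block_prob_def block1 ..
    also have "\<dots> = z k - \<P>(s in bernoulli_config \<rho>. \<not> ?u s 0 \<and> cars (?u s) 1 k = 0)"
      unfolding z[of k 1]
      by (intro prob_conj_eq_diff pred_intros_logic measurable_fi_step_iterate pred_cars_eq_0)
    also have "\<P>(s in bernoulli_config \<rho>. \<not> ?u s 0 \<and> cars (?u s) 1 k = 0) = z (Suc k)"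
      unfolding z[of "Suc k" 0] cars_Cons by simp
    finally show ?thesis .
  qed
  have gap: "block_prob m \<rho> t ([True] @ replicate k False @ [True]) = b k - b (Suc k)" for k
  proof -
    have "block_prob m \<rho> t ([True] @ replicate k False @ [True])
        = \<P>(s in bernoulli_config \<rho>. ?u s (1 + int k) \<and> ?u s 0 \<and> cars (?u s) 1 k = 0)"
      unfolding block_prob_def block2 ..
    also have "\<dots> = b k
        - \<P>(s in bernoulli_config \<rho>. \<not> ?u s (1 + int k) \<and> ?u s 0 \<and> cars (?u s) 1 k = 0)"
      unfolding b_def block_prob_def block1
      by (intro prob_conj_eq_diff pred_intros_logic measurable_fi_step_iterate pred_cars_eq_0)
    also have "\<P>(s in bernoulli_config \<rho>. \<not> ?u s (1 + int k) \<and> ?u s 0 \<and> cars (?u s) 1 k = 0) = b (Suc k)"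
      unfolding b_def block_prob_def block1 cars_Suc by (rule arg_cong[of _ _ prob]) auto
    finally show ?thesis .
  qed
  obtain n where n: "m = Suc n" using m by (cases m) auto
  have z1: "z 1 = 1 - \<rho>"
  proof -
    have "z 1 = \<P>(s in bernoulli_config \<rho>. \<not> ?u s 0)"
      unfolding z[of 1 0] by (simp add: cars_def)
    thus ?thesis
      using prob_conj_eq_diff[of "\<lambda>s. ?u s 0" "\<lambda>_. True", OF measurable_fi_step_iterate]
        prob_iterate_site[OF m, of t 0]
      by (simp add: prob_space[unfolded space_config])
  qed
  have "flow m \<rho> t = (\<Sum>k = 1..m - 1. real k * (b k - b (Suc k))) + real m * b m"
    unfolding flow_def gap by (simp only: b_def)
  also have "\<dots> = (\<Sum>k = 1..m. z k - z (Suc k))"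
    using sum_by_parts[of b n] unfolding b by (simp only: n diff_Suc_1)
  also have "\<dots> = z 1 - z (m + 1)"
    using sum_Suc_diff[of 1 m "\<lambda>k. - z k"] m by simp
  finally show ?thesis unfolding z1 by (simp add: z_def)
qed

end

theorem mainTheorem2:
  fixes m :: nat and \<rho> :: real
  assumes "m \<ge> 1" and "0 < \<rho>" and "\<rho> \<le> 1"
  shows "((\<lambda>t. block_prob m \<rho> t (replicate (m + 1) False)) \<longlonglongrightarrow>
            (if \<rho> < 1 / (real m + 1) then 1 - (real m + 1) * \<rho> else 0)) \<and>
         ((\<lambda>t. flow m \<rho> t) \<longlonglongrightarrow>
            (if \<rho> < 1 / (real m + 1) then real m * \<rho> else 1 - \<rho>))"
proof -
  interpret bernoulli_road \<rho> using assms by unfold_locales auto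
  let ?p = "if \<rho> < 1 / (real m + 1) then 1 - (real m + 1) * \<rho> else 0"
  have "max 0 (1 - real (m + 1) * \<rho>) = ?p"
    using assms by (auto simp: field_simps max_def)
  hence lim: "(\<lambda>t. block_prob m \<rho> t (replicate (m + 1) False)) \<longlonglongrightarrow> ?p"
    using idle_prob_tendsto[of "m + 1"] unfolding block_prob_zeros_eq_idle_prob[OF assms(1)] by simp
  have "(\<lambda>t. flow m \<rho> t) \<longlonglongrightarrow> 1 - \<rho> - ?p"
    unfolding flow_eq[OF assms(1)] by (intro tendsto_intros lim)
  moreover have "1 - \<rho> - ?p = (if \<rho> < 1 / (real m + 1) then real m * \<rho> else 1 - \<rho>)"
    by (simp add: algebra_simps)
  ultimately show ?thesis using lim by simp
qed

end
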